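(* Let $(\mathbf X,\mathbf A,\{\mathbf A(x)\},Q,c)$ be a Markov control process. Let $W:\mathbf X\to[0,\infty)$ be measurable, and let $K>0$, $\gamma\in(0,1)$, $\alpha\in(0,1)$, $\alpha_0\in(0,\alpha)$, $\beta:=\alpha_0/K$ and $w:=1+\beta W$. Let $\mathcal R$ be a risk map on the Markov control process (acting on $\mathscr B_w$) and $\nu$ a real-valued risk measure on $\mathscr B_w$. Assume: (1) $\overline{\mathcal R^\sharp}_{x,a}(W)\le\gamma W(x)+K$ for all $(x,a)\in\mathbf K$; (2) for some $R>2K/(1-\gamma)$, with $B=\{x\in\mathbf X:W(x)\le R\}$, for all $v\ge u$ in $\mathscr B_w$, $$\inf_{x\in B,\,(x,a)\in\mathbf K}\{\mathcal R_{x,a}(v)-\alpha\nu(v)-\mathcal R_{x,a}(u)+\alpha\nu(u)\}\ge0;$$ (3) there is a constant $\overline c\ge0$ with $\sup_{a\in\mathbf A(x)}|c(x,a)|\le\overline c\,w(x)$ for all $x\in\mathbf X$; (4) for each $x\in\mathbf X$: $a\mapsto c(x,a)$ is lower semicontinuous on $\mathbf A(x)$; $\mathbf A(x)$ is compact; and $a\mapsto\mathcal R_{x,a}(u)$ is continuous on $\mathbf A(x)$ for every $u\in\mathscr B_w$. Let $(\rho,h)\in\mathbb R\times\mathscr B_w$ be a solution of the average risk optimality equation $$\rho+h(x)=\inf_{a\in\mathbf A(x)}\{c(x,a)+\mathcal R_{x,a}(h)\},\quad x\in\mathbf X,$$ and let $f\in\Delta_D$ be an optimal selector of its right-hand side,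 i.e. a deterministic policy with $c^f(x)+\mathcal R^f_x(h)=\inf_{a\in\mathbf A(x)}\{c(x,a)+\mathcal R_{x,a}(h)\}$ for all $x\in\mathbf X$. Then $$\rho=J^*(x)=J(x,f^\infty)\quad\text{for all }x\in\mathbf X.$$
   Context: Markov control process: $\mathbf X,\mathbf A$ are Borel spaces (Borel subsets of complete separable metric spaces); for each $x\in\mathbf X$, $\mathbf A(x)\subset\mathbf A$ is a nonempty Borel set of feasible actions; $\mathbf K=\{(x,a):x\in\mathbf X,a\in\mathbf A(x)\}$ is a Borel subset of $\mathbf X\times\mathbf A$; $Q$ is a stochastic kernel on $\mathbf X$ given $\mathbf K$; $c:\mathbf K\to\mathbb R$ is measurable. $\Delta$ is the set of stochastic kernels $\pi$ on $\mathbf A$ given $\mathbf X$ with $\pi(\mathbf A(x)|x)=1$ for all $x$; $\Delta_D\subset\Delta$ is the set of deterministic ones (for each $x$ there is $a\in\mathbf A(x)$ with $f(\{a\}|x)=1$). Markov policies are sequences $\boldsymbol\pi=[\pi_0,\pi_1,\ldots]$ in $\Delta$; $\Pi_M=\Delta^\infty$; $f^\infty=[f,f,\ldots]$. $c^\pi(x)=\int_{\mathbf A(x)}c(x,a)\pi(da|x)$. For measurable $w:\mathbf X\to[1,\infty)$, $\mathscr B_w$ is the space of measurable $u:\mathbf X\to\mathbb R$ with $\|u\|_w=\sup_x|u(x)|/w(x)<\infty$. A real-valued risk measure on $\mathscr B_w$ is a map $\nu:\mathscr B_w\to\mathbb R$ with: $\nu(v)\le\nu(u)$ if $v\le u$ pointwise;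 $\nu(v+r)=\nu(v)+r$ for constants $r\in\mathbb R$; $\nu(0)=0$. A risk map on the Markov control process is a function $\mathcal R_{x,a}(v)=\mathcal R(v|x,a)$, $v\in\mathscr B_w$, $(x,a)\in\mathbf K$, such that $\mathcal R_{x,a}$ is a real-valued risk measure on $\mathscr B_w$ for each $(x,a)\in\mathbf K$ and $(x,a)\mapsto\mathcal R_{x,a}(v)$ is a real-valued measurable function on $\mathbf K$ for each $v\in\mathscr B_w$. For $\pi\in\Delta$, $\mathcal R^\pi_x(v)=\int_{\mathbf A(x)}\pi(da|x)\mathcal R_{x,a}(v)$, and $\mathcal R^\pi(v)$ is the function $x\mapsto\mathcal R^\pi_x(v)$. Put $\mathcal R^\sharp_{x,a}(v)=\sup_{u\in\mathscr B_w}\{\mathcal R_{x,a}(v+u)-\mathcal R_{x,a}(u)\}\in\mathbb R\cup\{\infty\}$ and $\overline{\mathcal R^\sharp}_{x,a}(v)=\sup_{\lambda\in\mathbb R,\lambda\neq0}\mathcal R^\sharp_{x,a}(\lambda v)/\lambda$. For $\boldsymbol\pi\in\Pi_M$: $J_T(x,\boldsymbol\pi)=c^{\pi_0}(x)+\mathcal R^{\pi_0}_x\big(c^{\pi_1}+\mathcal R^{\pi_1}(c^{\pi_2}+\cdots+\mathcal R^{\pi_{T-1}}(c^{\pi_T})\cdots)\big)$; the average risk is $J(x,\boldsymbol\pi)=\limsup_{T\to\infty}\frac1TJ_T(x,\boldsymbol\pi)$; $J^*(x)=\inf_{\boldsymbol\pi\in\Pi_M}J(x,\boldsymbol\pi)$.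 Under the assumptions of the claim a solution $(\rho,h)$ and an optimal selector $f$ exist. *)

theory Defs
  imports "HOL-Probability.Probability"
begin

text \<open>
  The Borel spaces are Borel subsets \<open>X\<close>, \<open>A\<close> of Polish types. Real functions on \<open>X\<close> are functions on
  the whole type whose values outside \<open>X\<close> are irrelevant: every condition only looks at points of \<open>X\<close>,
  and in particular the monotonicity required of a risk measure is with respect to the pointwise
  order on \<open>X\<close>, so a risk measure takes equal values on functions that agree on \<open>X\<close>. Possibly infinite
  suprema and infima are taken in \<open>ereal\<close>.
\<close>

abbreviation Borel_on :: "'a::topological_space set \<Rightarrow> 'a measure" where
  "Borel_on S \<equiv> restrict_space borel S"

definition feasible_pairs :: "'x set \<Rightarrow> ('x \<Rightarrow> 'a set) \<Rightarrow> ('x \<times> 'a) set" where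
  "feasible_pairs X AA = {(x, a). x \<in> X \<and> a \<in> AA x}"

definition markov_control_process ::
  "'x::polish_space set \<Rightarrow> 'a::polish_space set \<Rightarrow> ('x \<Rightarrow> 'a set) \<Rightarrow> ('x \<times> 'a \<Rightarrow> 'x measure)
    \<Rightarrow> ('x \<Rightarrow> 'a \<Rightarrow> real) \<Rightarrow> bool" where
  "markov_control_process X A AA Q c \<longleftrightarrow>
     X \<in> sets borel \<and> A \<in> sets borel \<and>
     (\<forall>x\<in>X. AA x \<noteq> {} \<and> AA x \<subseteq> A \<and> AA x \<in> sets borel) \<and>
     feasible_pairs X AA \<in> sets borel \<and>
     Q \<in> Borel_on (feasible_pairs X AA) \<rightarrow>\<^sub>M prob_algebra (Borel_on X) \<and>
     (\<lambda>(x, a). c x a) \<in> borel_measurable (Borel_on (feasible_pairs X AA))"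

subsection \<open>Policies\<close>

definition kernels ::
  "'x::polish_space set \<Rightarrow> 'a::polish_space set \<Rightarrow> ('x \<Rightarrow> 'a set) \<Rightarrow> ('x \<Rightarrow> 'a measure) set" where
  "kernels X A AA =
     {\<pi> \<in> Borel_on X \<rightarrow>\<^sub>M prob_algebra (Borel_on A). \<forall>x\<in>X. measure (\<pi> x) (AA x) = 1}"

definition det_kernels ::
  "'x::polish_space set \<Rightarrow> 'a::polish_space set \<Rightarrow> ('x \<Rightarrow> 'a set) \<Rightarrow> ('x \<Rightarrow> 'a measure) set" where
  "det_kernels X A AA = {f \<in> kernels X A AA. \<forall>x\<in>X. \<exists>a\<in>AA x. measure (f x) {a} = 1}"

definition markov_policies ::
  "'x::polish_space set \<Rightarrow> 'a::polish_space set \<Rightarrow> ('x \<Rightarrow> 'a set) \<Rightarrow> (nat \<Rightarrow> 'x \<Rightarrow> 'a measure) set" where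
  "markov_policies X A AA = {\<pi>. \<forall>t. \<pi> t \<in> kernels X A AA}"

definition stationary :: "('x \<Rightarrow> 'a measure) \<Rightarrow> nat \<Rightarrow> 'x \<Rightarrow> 'a measure" where
  "stationary f = (\<lambda>_. f)"

subsection \<open>Risk measures and risk maps\<close>

definition weighted_norm :: "'x set \<Rightarrow> ('x \<Rightarrow> real) \<Rightarrow> ('x \<Rightarrow> real) \<Rightarrow> ereal" where
  "weighted_norm X w u = (SUP x\<in>X. ereal (\<bar>u x\<bar> / w x))"

definition Bw :: "'x::topological_space set \<Rightarrow> ('x \<Rightarrow> real) \<Rightarrow> ('x \<Rightarrow> real) set" where
  "Bw X w = {u \<in> borel_measurable (Borel_on X). weighted_norm X w u < \<infinity>}"

definition risk_measure ::
  "'x::topological_space set \<Rightarrow> ('x \<Rightarrow> real) \<Rightarrow> (('x \<Rightarrow> real) \<Rightarrow> real) \<Rightarrow> bool" where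
  "risk_measure X w \<nu> \<longleftrightarrow>
     (\<forall>v\<in>Bw X w. \<forall>u\<in>Bw X w. (\<forall>x\<in>X. v x \<le> u x) \<longrightarrow> \<nu> v \<le> \<nu> u) \<and>
     (\<forall>v\<in>Bw X w. \<forall>r. \<nu> (\<lambda>x. v x + r) = \<nu> v + r) \<and>
     \<nu> (\<lambda>x. 0) = 0"

definition risk_map ::
  "'x::polish_space set \<Rightarrow> ('x \<Rightarrow> 'a::polish_space set) \<Rightarrow> ('x \<Rightarrow> real)
    \<Rightarrow> ('x \<Rightarrow> 'a \<Rightarrow> ('x \<Rightarrow> real) \<Rightarrow> real) \<Rightarrow> bool" where
  "risk_map X AA w \<R> \<longleftrightarrow>
     (\<forall>(x, a)\<in>feasible_pairs X AA. risk_measure X w (\<R> x a)) \<and>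
     (\<forall>v\<in>Bw X w. (\<lambda>(x, a). \<R> x a v) \<in> borel_measurable (Borel_on (feasible_pairs X AA)))"

definition sharp ::
  "'x::topological_space set \<Rightarrow> ('x \<Rightarrow> real) \<Rightarrow> (('x \<Rightarrow> real) \<Rightarrow> real) \<Rightarrow> ('x \<Rightarrow> real) \<Rightarrow> ereal" where
  "sharp X w \<nu> v = (SUP u\<in>Bw X w. ereal (\<nu> (\<lambda>x. v x + u x) - \<nu> u))"

definition sharp_bar ::
  "'x::topological_space set \<Rightarrow> ('x \<Rightarrow> real) \<Rightarrow> (('x \<Rightarrow> real) \<Rightarrow> real) \<Rightarrow> ('x \<Rightarrow> real) \<Rightarrow> ereal" where
  "sharp_bar X w \<nu> v = (SUP l\<in>{l::real. l \<noteq> 0}. sharp X w \<nu> (\<lambda>x. l * v x) / ereal l)"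

subsection \<open>Total and average risk\<close>

definition policy_cost ::
  "('x \<Rightarrow> 'a set) \<Rightarrow> ('x \<Rightarrow> 'a \<Rightarrow> real) \<Rightarrow> ('x \<Rightarrow> 'a measure) \<Rightarrow> 'x \<Rightarrow> real" where
  "policy_cost AA c \<pi> x = (LINT a:AA x|\<pi> x. c x a)"

definition policy_risk ::
  "('x \<Rightarrow> 'a set) \<Rightarrow> ('x \<Rightarrow> 'a \<Rightarrow> ('x \<Rightarrow> real) \<Rightarrow> real) \<Rightarrow> ('x \<Rightarrow> 'a measure)
    \<Rightarrow> ('x \<Rightarrow> real) \<Rightarrow> 'x \<Rightarrow> real" where
  "policy_risk AA \<R> \<pi> v x = (LINT a:AA x|\<pi> x. \<R> x a v)"

text \<open>The nested total risk over the horizon \<open>T\<close>, by recursion on the tail of the policy.\<close>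

primrec total_risk ::
  "('x \<Rightarrow> 'a set) \<Rightarrow> ('x \<Rightarrow> 'a \<Rightarrow> real) \<Rightarrow> ('x \<Rightarrow> 'a \<Rightarrow> ('x \<Rightarrow> real) \<Rightarrow> real)
    \<Rightarrow> nat \<Rightarrow> (nat \<Rightarrow> 'x \<Rightarrow> 'a measure) \<Rightarrow> 'x \<Rightarrow> real" where
  "total_risk AA c \<R> 0 \<pi> = policy_cost AA c (\<pi> 0)"
| "total_risk AA c \<R> (Suc T) \<pi> =
     (\<lambda>x. policy_cost AA c (\<pi> 0) x
          + policy_risk AA \<R> (\<pi> 0) (total_risk AA c \<R> T (\<lambda>t. \<pi> (Suc t))) x)"

definition average_risk ::
  "('x \<Rightarrow> 'a set) \<Rightarrow> ('x \<Rightarrow> 'a \<Rightarrow> real) \<Rightarrow> ('x \<Rightarrow> 'a \<Rightarrow> ('x \<Rightarrow> real) \<Rightarrow> real)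
    \<Rightarrow> 'x \<Rightarrow> (nat \<Rightarrow> 'x \<Rightarrow> 'a measure) \<Rightarrow> ereal" where
  "average_risk AA c \<R> x \<pi> = limsup (\<lambda>T. ereal (1 / real T * total_risk AA c \<R> T \<pi> x))"

definition optimal_average_risk ::
  "'x::polish_space set \<Rightarrow> 'a::polish_space set \<Rightarrow> ('x \<Rightarrow> 'a set) \<Rightarrow> ('x \<Rightarrow> 'a \<Rightarrow> real)
    \<Rightarrow> ('x \<Rightarrow> 'a \<Rightarrow> ('x \<Rightarrow> real) \<Rightarrow> real) \<Rightarrow> 'x \<Rightarrow> ereal" where
  "optimal_average_risk X A AA c \<R> x = (INF \<pi>\<in>markov_policies X A AA. average_risk AA c \<R> x \<pi>)"

subsection \<open>The average risk optimality equation\<close>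

definition aroe_rhs ::
  "('x \<Rightarrow> 'a set) \<Rightarrow> ('x \<Rightarrow> 'a \<Rightarrow> real) \<Rightarrow> ('x \<Rightarrow> 'a \<Rightarrow> ('x \<Rightarrow> real) \<Rightarrow> real)
    \<Rightarrow> ('x \<Rightarrow> real) \<Rightarrow> 'x \<Rightarrow> ereal" where
  "aroe_rhs AA c \<R> h x = (INF a\<in>AA x. ereal (c x a + \<R> x a h))"

definition aroe_solution ::
  "'x::topological_space set \<Rightarrow> ('x \<Rightarrow> 'a set) \<Rightarrow> ('x \<Rightarrow> 'a \<Rightarrow> real)
    \<Rightarrow> ('x \<Rightarrow> 'a \<Rightarrow> ('x \<Rightarrow> real) \<Rightarrow> real) \<Rightarrow> ('x \<Rightarrow> real) \<Rightarrow> real \<Rightarrow> ('x \<Rightarrow> real) \<Rightarrow> bool" where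
  "aroe_solution X AA c \<R> w \<rho> h \<longleftrightarrow>
     h \<in> Bw X w \<and> (\<forall>x\<in>X. ereal (\<rho> + h x) = aroe_rhs AA c \<R> h x)"

definition optimal_selector ::
  "'x::polish_space set \<Rightarrow> 'a::polish_space set \<Rightarrow> ('x \<Rightarrow> 'a set) \<Rightarrow> ('x \<Rightarrow> 'a \<Rightarrow> real)
    \<Rightarrow> ('x \<Rightarrow> 'a \<Rightarrow> ('x \<Rightarrow> real) \<Rightarrow> real) \<Rightarrow> ('x \<Rightarrow> real) \<Rightarrow> ('x \<Rightarrow> 'a measure) \<Rightarrow> bool" where
  "optimal_selector X A AA c \<R> h f \<longleftrightarrow>
     f \<in> det_kernels X A AA \<and>
     (\<forall>x\<in>X. ereal (policy_cost AA c f x + policy_risk AA \<R> f h x) = aroe_rhs AA c \<R> h x)"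

definition lower_semicontinuous_on :: "'a::topological_space set \<Rightarrow> ('a \<Rightarrow> real) \<Rightarrow> bool" where
  "lower_semicontinuous_on S g \<longleftrightarrow> (\<forall>a\<in>S. \<forall>y<g a. \<forall>\<^sub>F b in at a within S. y < g b)"

end

theory Submission
  imports Defs
begin

text \<open>
  The Lyapunov drift alone makes the terminal value negligible: if two terminal values differ by at
  most \<open>s + b * W\<close>, one step of the risk map turns this into \<open>(s + b * K) + (b * \<gamma>) * W\<close>, so after any
  number of steps the difference stays below \<open>s + b * K / (1 - \<gamma>) + b * W\<close>. Replacing the terminal
  value \<open>0\<close> by \<open>h\<close> therefore changes the total risk by an amount bounded in the horizon, and with
  terminal value \<open>h\<close> the optimality equation telescopes to \<open>(T + 1) * \<rho> + h\<close>, as a lower bound for every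
  Markov policy and with equality for the optimal selector. Dividing by \<open>T\<close> gives the claim.
\<close>

section \<open>Integration against kernels and probability measures\<close>

text \<open>Facts proved for \<open>policy_cost\<close> with an arbitrary integrand thus serve both
  the cost and the risk.\<close>

lemma policy_risk_conv_policy_cost:
  "policy_risk AA \<R> \<pi> v = policy_cost AA (\<lambda>x a. \<R> x a v) \<pi>"
  by (simp add: fun_eq_iff policy_risk_def policy_cost_def)

lemma set_lebesgue_integral_const_prob:
  fixes k :: real
  assumes "prob_space M" "S \<in> sets M" "measure M S = 1"
  shows "(LINT a:S|M. k) = k"
proof -
  interpret prob_space M by fact
  show ?thesis using assms by (simp add: set_lebesgue_integral_def)
qed

lemma integral_measurable_subprob_algebra2:
  fixes \<phi> :: "'a \<Rightarrow> 'b \<Rightarrow> real"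
  assumes \<phi>: "(\<lambda>(x, y). \<phi> x y) \<in> borel_measurable (M \<Otimes>\<^sub>M N)"
    and L: "L \<in> M \<rightarrow>\<^sub>M subprob_algebra N"
  shows "(\<lambda>x. \<integral>y. \<phi> x y \<partial>L x) \<in> borel_measurable M"
proof -
  have "(\<lambda>x. distr (L x) (M \<Otimes>\<^sub>M N) (\<lambda>y. (x, y))) \<in> M \<rightarrow>\<^sub>M subprob_algebra (M \<Otimes>\<^sub>M N)"
    by (rule measurable_distr2[OF _ L]) simp
  from measurable_compose[OF this integral_measurable_subprob_algebra[OF \<phi>]]
  have "(\<lambda>x. \<integral>p. (case p of (x, y) \<Rightarrow> \<phi> x y) \<partial>distr (L x) (M \<Otimes>\<^sub>M N) (\<lambda>y. (x, y)))
    \<in> borel_measurable M" .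
  moreover have "(\<integral>p. (case p of (x, y) \<Rightarrow> \<phi> x y) \<partial>distr (L x) (M \<Otimes>\<^sub>M N) (\<lambda>y. (x, y)))
      = (\<integral>y. \<phi> x y \<partial>L x)" if "x \<in> space M" for x
  proof (subst integral_distr)
    show "(\<lambda>y. (x, y)) \<in> L x \<rightarrow>\<^sub>M M \<Otimes>\<^sub>M N"
      using measurable_Pair1'[OF that, of N] sets_kernel[OF L that]
      by (simp cong: measurable_cong_sets)
  qed (use \<phi> in simp_all)
  ultimately show ?thesis by (simp cong: measurable_cong)
qed

lemma (in prob_space) set_integrable_bounded:
  fixes \<phi> :: "'a \<Rightarrow> real"
  assumes "(\<lambda>a. indicator S a * \<phi> a) \<in> borel_measurable M"
    and "\<And>a. a \<in> S \<Longrightarrow> \<bar>\<phi> a\<bar> \<le> B"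
  shows "set_integrable M S \<phi>"
  unfolding set_integrable_def
\<comment> \<open>If \<open>S\<close> is empty, \<open>B\<close> may be negative although the
  integrand is 0.\<close>
proof (rule integrable_const_bound[where B = "max B 0"])
  show "AE a in M. norm (indicator S a *\<^sub>R \<phi> a) \<le> max B 0"
    using assms(2) by (intro AE_I2) (auto simp: indicator_def le_max_iff_disj)
qed (use assms(1) in simp)

lemma (in prob_space) set_integrable_const:
  fixes k :: real
  assumes "S \<in> events"
  shows "set_integrable M S (\<lambda>a. k)"
  using assms by (intro set_integrable_bounded[where B = "\<bar>k\<bar>"]) auto

section \<open>The weighted function space under the drift condition\<close>

locale drift_risk_map =
  fixes X :: "'x::polish_space set" and A :: "'a::polish_space set"
    and AA :: "'x \<Rightarrow> 'a set" and Q :: "'x \<times> 'a \<Rightarrow> 'x measure" and c :: "'x \<Rightarrow> 'a \<Rightarrow> real"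
    and W w :: "'x \<Rightarrow> real" and K \<gamma> \<beta> c_bar :: real
    and \<R> :: "'x \<Rightarrow> 'a \<Rightarrow> ('x \<Rightarrow> real) \<Rightarrow> real"
  assumes mcp: "markov_control_process X A AA Q c"
    and W_meas: "W \<in> borel_measurable (Borel_on X)" and W_nonneg: "\<forall>x\<in>X. 0 \<le> W x"
    and \<gamma>: "0 < \<gamma>" "\<gamma> < 1" and \<beta>: "0 < \<beta>"
    and w: "w = (\<lambda>x. 1 + \<beta> * W x)"
    and risk_map: "risk_map X AA w \<R>"
    and drift: "\<forall>(x, a)\<in>feasible_pairs X AA. sharp_bar X w (\<R> x a) W \<le> ereal (\<gamma> * W x + K)"
    and c_bar: "\<forall>x\<in>X. (SUP a\<in>AA x. ereal \<bar>c x a\<bar>) \<le> ereal (c_bar * w x)"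
begin

text \<open>Since \<open>1 \<le> w\<close> and \<open>\<beta> * W \<le> w\<close>, a bound affine in
  \<open>W\<close> is a bound by a multiple of \<open>w\<close>. Later estimates keep the affine
  form because the drift condition is stated for \<open>W\<close>.\<close>

lemma Bw_I:
  assumes "u \<in> borel_measurable (Borel_on X)" "\<And>x. x \<in> X \<Longrightarrow> \<bar>u x\<bar> \<le> s + b * W x"
  shows "u \<in> Bw X w"
proof -
  have "ereal (\<bar>u x\<bar> / w x) \<le> ereal (\<bar>s\<bar> + \<bar>b\<bar> / \<beta>)" if x: "x \<in> X" for x
  proof -
    have W: "0 \<le> W x" using W_nonneg x by auto
    have w1: "1 \<le> w x" using W \<beta> by (simp add: w)
    have "\<bar>u x\<bar> \<le> \<bar>s\<bar> + \<bar>b\<bar> * W x"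
      using assms(2)[OF x] W by (smt (verit) mult_right_mono)
    also have "\<dots> \<le> \<bar>s\<bar> * w x + (\<bar>b\<bar> / \<beta>) * w x"
    proof (intro add_mono)
      show "\<bar>s\<bar> \<le> \<bar>s\<bar> * w x" using w1 by (simp add: mult_le_cancel_left1)
      have "\<bar>b\<bar> * W x = (\<bar>b\<bar> / \<beta>) * (\<beta> * W x)" using \<beta> by simp
      also have "\<dots> \<le> (\<bar>b\<bar> / \<beta>) * w x" using \<beta> by (intro mult_left_mono) (auto simp: w)
      finally show "\<bar>b\<bar> * W x \<le> (\<bar>b\<bar> / \<beta>) * w x" .
    qed
    finally show ?thesis using w1 by (simp add: pos_divide_le_eq ring_distribs)
  qed
  then have "weighted_norm X w u \<le> ereal (\<bar>s\<bar> + \<bar>b\<bar> / \<beta>)"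
    unfolding weighted_norm_def by (rule SUP_least)
  then show ?thesis using assms(1) by (auto simp: Bw_def)
qed

lemma Bw_E:
  assumes "u \<in> Bw X w"
  obtains b where "0 < b" "\<And>x. x \<in> X \<Longrightarrow> \<bar>u x\<bar> \<le> b + b * W x"
proof -
  have "weighted_norm X w u < \<infinity>" using assms by (simp add: Bw_def)
  then obtain C where C: "weighted_norm X w u < ereal C"
    using less_PInf_Ex_of_nat by fastforce
  \<comment> \<open>The maximum makes \<open>b\<close> positive, so that \<open>risk_step\<close>
    can divide by it; the factor comes from
    \<open>1 + \<beta> * W x \<le> (1 + \<beta>) * (1 + W x)\<close>.\<close>
  define b where "b = max 1 C * (1 + \<beta>)"
  have "\<bar>u x\<bar> \<le> b + b * W x" if x: "x \<in> X" for x
  proof -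
    have W: "0 \<le> W x" using W_nonneg x by auto
    have w1: "1 \<le> w x" using W \<beta> by (simp add: w)
    have "ereal (\<bar>u x\<bar> / w x) \<le> weighted_norm X w u"
      unfolding weighted_norm_def by (rule SUP_upper) (rule x)
    then have "ereal (\<bar>u x\<bar> / w x) < ereal C" using C by order
    then have "\<bar>u x\<bar> \<le> C * w x" using w1 by (simp add: pos_divide_less_eq)
    also have "\<dots> \<le> max 1 C * w x" using w1 by (intro mult_right_mono) auto
    also have "\<dots> \<le> max 1 C * ((1 + \<beta>) * (1 + W x))"
      using W \<beta> by (intro mult_left_mono) (auto simp: w algebra_simps)
    finally show ?thesis by (simp add: b_def algebra_simps)
  qed
  moreover have "0 < b" unfolding b_def using \<beta> by (intro mult_pos_pos) auto
  ultimately show ?thesis using that by blast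
qed

lemma Bw_measurable: "u \<in> Bw X w \<Longrightarrow> u \<in> borel_measurable (Borel_on X)"
  by (simp add: Bw_def)

lemma Bw_const: "(\<lambda>x. k) \<in> Bw X w"
  by (rule Bw_I[where s = "\<bar>k\<bar>" and b = 0]) auto

lemma Bw_add:
  assumes "u \<in> Bw X w" "v \<in> Bw X w"
  shows "(\<lambda>x. u x + v x) \<in> Bw X w"
proof -
  obtain b where b: "\<And>x. x \<in> X \<Longrightarrow> \<bar>u x\<bar> \<le> b + b * W x" using Bw_E[OF assms(1)] by blast
  obtain d where d: "\<And>x. x \<in> X \<Longrightarrow> \<bar>v x\<bar> \<le> d + d * W x" using Bw_E[OF assms(2)] by blast
  show ?thesis
  proof (rule Bw_I[where s = "b + d" and b = "b + d"])
    show "\<bar>u x + v x\<bar> \<le> b + d + (b + d) * W x" if "x \<in> X" for x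
      using b[OF that] d[OF that] by (simp add: algebra_simps)
  qed (use Bw_measurable assms in simp)
qed

lemma Bw_scaled_W: "(\<lambda>x. b * W x) \<in> Bw X w"
  by (rule Bw_I[where s = 0 and b = "\<bar>b\<bar>"])
    (use W_meas W_nonneg in \<open>auto simp: abs_mult\<close>)

section \<open>One-step estimates for the risk map\<close>

lemma risk_measure_feasible:
  "x \<in> X \<Longrightarrow> a \<in> AA x \<Longrightarrow> risk_measure X w (\<R> x a)"
  using risk_map by (auto simp: risk_map_def feasible_pairs_def)

lemma risk_zero: "x \<in> X \<Longrightarrow> a \<in> AA x \<Longrightarrow> \<R> x a (\<lambda>x. 0) = 0"
  using risk_measure_feasible[of x a] by (simp add: risk_measure_def)

text \<open>Monotonicity and translation invariance replace \<open>v\<close> by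
  \<open>u + b * W\<close> at the price of \<open>s\<close>. The increment from \<open>u\<close> to
  \<open>u + b * W\<close> is a term of the supremum \<open>sharp\<close>, and its quotient by
  \<open>b\<close> lies below the term \<open>l = b\<close> of \<open>sharp_bar\<close>, which the
  drift condition bounds.\<close>

lemma risk_step:
  assumes xa: "x \<in> X" "a \<in> AA x" and v: "v \<in> Bw X w" and u: "u \<in> Bw X w" and b: "0 < b"
    and le: "\<And>y. y \<in> X \<Longrightarrow> v y \<le> u y + s + b * W y"
  shows "\<R> x a v \<le> \<R> x a u + s + b * (\<gamma> * W x + K)"
proof -
  note rm = risk_measure_feasible[OF xa, unfolded risk_measure_def]
  have bWu: "(\<lambda>x. b * W x + u x) \<in> Bw X w" using Bw_add[OF Bw_scaled_W u] .
  have "\<R> x a v \<le> \<R> x a (\<lambda>y. (b * W y + u y) + s)"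
    using rm v Bw_add[OF bWu Bw_const[of s]] le by (simp add: add_ac)
  also have "\<dots> = \<R> x a (\<lambda>y. b * W y + u y) + s"
    using rm[THEN conjunct2, THEN conjunct1, THEN bspec, OF bWu] by simp
  finally have 1: "\<R> x a v \<le> \<R> x a (\<lambda>y. b * W y + u y) + s" .
  let ?d = "\<R> x a (\<lambda>y. b * W y + u y) - \<R> x a u"
  have "ereal ?d \<le> sharp X w (\<R> x a) (\<lambda>y. b * W y)"
    unfolding sharp_def by (rule SUP_upper) (rule u)
  then have "ereal ?d / ereal b \<le> sharp X w (\<R> x a) (\<lambda>y. b * W y) / ereal b"
    using b by (intro ereal_divide_right_mono) auto
  also have "\<dots> \<le> sharp_bar X w (\<R> x a) W"
    unfolding sharp_bar_def using b by (intro SUP_upper) auto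
  also have "\<dots> \<le> ereal (\<gamma> * W x + K)"
    using drift xa by (auto simp: feasible_pairs_def)
  finally have "?d / b \<le> \<gamma> * W x + K" using b by simp
  then have "?d \<le> b * (\<gamma> * W x + K)" using b by (simp add: pos_divide_le_eq mult.commute)
  with 1 show ?thesis by simp
qed

text \<open>Compares \<open>v\<close> with the zero function in both directions through
  \<open>risk_step\<close>. The bound is uniform in the action, as integration under a policy
  needs.\<close>

lemma risk_bound:
  assumes "v \<in> Bw X w"
  obtains s b where "\<And>x a. x \<in> X \<Longrightarrow> a \<in> AA x \<Longrightarrow> \<bar>\<R> x a v\<bar> \<le> s + b * W x"
proof -
  obtain b where b: "0 < b" "\<And>x. x \<in> X \<Longrightarrow> \<bar>v x\<bar> \<le> b + b * W x" using Bw_E[OF assms] by blast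
  have "\<bar>\<R> x a v\<bar> \<le> (b + b * K) + (b * \<gamma>) * W x" if xa: "x \<in> X" "a \<in> AA x" for x a
    using risk_step[OF xa assms Bw_const[of 0] b(1), of b]
      risk_step[OF xa Bw_const[of 0] assms b(1), of b] b(2) risk_zero[OF xa]
    by (fastforce simp: abs_le_iff algebra_simps)
  then show ?thesis using that by blast
qed

lemma cost_bound: "x \<in> X \<Longrightarrow> a \<in> AA x \<Longrightarrow> \<bar>c x a\<bar> \<le> c_bar + (c_bar * \<beta>) * W x"
proof -
  assume xa: "x \<in> X" "a \<in> AA x"
  have "ereal \<bar>c x a\<bar> \<le> (SUP a\<in>AA x. ereal \<bar>c x a\<bar>)" by (rule SUP_upper) (rule xa)
  also have "\<dots> \<le> ereal (c_bar * w x)" using c_bar xa by blast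
  finally show ?thesis by (simp add: w algebra_simps)
qed

section \<open>Measurability and integrability under a policy\<close>

lemma kernel_prob_space:
  assumes "\<pi> \<in> kernels X A AA" "x \<in> X"
  shows "prob_space (\<pi> x)" "sets (\<pi> x) = sets (Borel_on A)" "measure (\<pi> x) (AA x) = 1"
    "AA x \<in> sets (\<pi> x)"
proof -
  have "\<pi> \<in> Borel_on X \<rightarrow>\<^sub>M prob_algebra (Borel_on A)" and 1: "measure (\<pi> x) (AA x) = 1"
    using assms by (auto simp: kernels_def)
  then have "\<pi> x \<in> space (prob_algebra (Borel_on A))"
    using assms(2) by (auto dest: measurable_space simp: space_restrict_space)
  then show 2: "prob_space (\<pi> x)" "sets (\<pi> x) = sets (Borel_on A)"
    by (auto simp: space_prob_algebra)
  show "measure (\<pi> x) (AA x) = 1" by (fact 1)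
  \<comment> \<open>A nonmeasurable set has \<open>measure\<close> 0, so the value 1 forces
    measurability.\<close>
  then show "AA x \<in> sets (\<pi> x)" using measure_notin_sets by fastforce
qed

text \<open>Policies integrate over sections, so a function on the feasible pairs is carried to the
  whole rectangle by 0. This is measurable because the feasible pairs form a Borel set and, on
  Polish spaces, the Borel sets of the product generate the product sigma-algebra.\<close>

lemma measurable_zero_extension:
  assumes "(\<lambda>(x, a). \<phi> x a) \<in> borel_measurable (Borel_on (feasible_pairs X AA))"
  shows "(\<lambda>(x, a). indicator (AA x) a * \<phi> x a :: real)
    \<in> borel_measurable (Borel_on X \<Otimes>\<^sub>M Borel_on A)"
proof -
  let ?g = "\<lambda>p. indicator (feasible_pairs X AA) p * (case p of (x, a) \<Rightarrow> \<phi> x a) :: real"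
  have "feasible_pairs X AA \<in> sets borel" using mcp by (simp add: markov_control_process_def)
  then have "?g \<in> borel_measurable borel"
    using assms by (simp add: borel_measurable_restrict_space_iff)
  then have g: "?g \<in> borel_measurable (borel \<Otimes>\<^sub>M borel)" by (simp add: borel_prod)
  have "(\<lambda>p. (fst p, snd p)) \<in> Borel_on X \<Otimes>\<^sub>M Borel_on A \<rightarrow>\<^sub>M borel \<Otimes>\<^sub>M borel"
  proof (rule measurable_Pair)
    show "fst \<in> Borel_on X \<Otimes>\<^sub>M Borel_on A \<rightarrow>\<^sub>M borel"
      by (rule measurable_compose[OF measurable_fst]) (simp add: measurable_restrict_space1)
    show "snd \<in> Borel_on X \<Otimes>\<^sub>M Borel_on A \<rightarrow>\<^sub>M borel"
      by (rule measurable_compose[OF measurable_snd]) (simp add: measurable_restrict_space1)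
  qed
  from measurable_compose[OF this g]
  have "?g \<in> borel_measurable (Borel_on X \<Otimes>\<^sub>M Borel_on A)" by simp
  moreover have "?g p = (case p of (x, a) \<Rightarrow> indicator (AA x) a * \<phi> x a)"
    if "p \<in> space (Borel_on X \<Otimes>\<^sub>M Borel_on A)" for p
    using that by (auto simp: space_pair_measure space_restrict_space feasible_pairs_def
      indicator_def)
  ultimately show ?thesis by (simp cong: measurable_cong)
qed

lemma policy_cost_measurable:
  assumes "\<pi> \<in> kernels X A AA"
    and "(\<lambda>(x, a). \<phi> x a) \<in> borel_measurable (Borel_on (feasible_pairs X AA))"
  shows "policy_cost AA \<phi> \<pi> \<in> borel_measurable (Borel_on X)"
proof -
  have "\<pi> \<in> Borel_on X \<rightarrow>\<^sub>M subprob_algebra (Borel_on A)"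
    using assms(1) by (auto simp: kernels_def intro: measurable_prob_algebraD)
  with measurable_zero_extension[OF assms(2)]
  have "(\<lambda>x. \<integral>a. indicator (AA x) a * \<phi> x a \<partial>\<pi> x) \<in> borel_measurable (Borel_on X)"
    by (rule integral_measurable_subprob_algebra2)
  then show ?thesis by (simp add: policy_cost_def[abs_def] set_lebesgue_integral_def)
qed

lemma policy_cost_integrable:
  fixes \<phi> :: "'x \<Rightarrow> 'a \<Rightarrow> real"
  assumes \<pi>: "\<pi> \<in> kernels X A AA"
    and \<phi>: "(\<lambda>(x, a). \<phi> x a) \<in> borel_measurable (Borel_on (feasible_pairs X AA))"
    and x: "x \<in> X" and B: "\<And>a. a \<in> AA x \<Longrightarrow> \<bar>\<phi> x a\<bar> \<le> B"
  shows "set_integrable (\<pi> x) (AA x) (\<phi> x)"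
proof -
  interpret prob_space "\<pi> x" using kernel_prob_space[OF \<pi> x] by blast
  show ?thesis
  proof (rule set_integrable_bounded[where B = B])
    have "(\<lambda>a. (x, a)) \<in> Borel_on A \<rightarrow>\<^sub>M Borel_on X \<Otimes>\<^sub>M Borel_on A"
      by (rule measurable_Pair1') (simp add: space_restrict_space x)
    from measurable_compose[OF this measurable_zero_extension[OF \<phi>]]
    show "(\<lambda>a. indicator (AA x) a * \<phi> x a) \<in> borel_measurable (\<pi> x)"
      using kernel_prob_space(2)[OF \<pi> x] by (simp cong: measurable_cong_sets)
  qed (rule B)
qed

lemma policy_cost_in_Bw:
  assumes \<pi>: "\<pi> \<in> kernels X A AA"
    and \<phi>: "(\<lambda>(x, a). \<phi> x a) \<in> borel_measurable (Borel_on (feasible_pairs X AA))"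
    and B: "\<And>x a. x \<in> X \<Longrightarrow> a \<in> AA x \<Longrightarrow> \<bar>\<phi> x a\<bar> \<le> s + b * W x"
  shows "policy_cost AA \<phi> \<pi> \<in> Bw X w"
proof (rule Bw_I[OF policy_cost_measurable[OF \<pi> \<phi>]])
  fix x assume x: "x \<in> X"
  note P = kernel_prob_space[OF \<pi> x]
  interpret prob_space "\<pi> x" by (rule P)
  have I: "set_integrable (\<pi> x) (AA x) (\<phi> x)"
    using policy_cost_integrable[OF \<pi> \<phi> x B[OF x]] by blast
  note C = set_integrable_const[OF P(4)]
  have "policy_cost AA \<phi> \<pi> x \<le> (LINT a:AA x|\<pi> x. s + b * W x)"
    unfolding policy_cost_def
    by (rule set_integral_mono[OF I C]) (use B[OF x] in \<open>auto simp: abs_le_iff\<close>)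
  moreover have "(LINT a:AA x|\<pi> x. - (s + b * W x)) \<le> policy_cost AA \<phi> \<pi> x"
    unfolding policy_cost_def
    by (rule set_integral_mono[OF C I]) (use B[OF x] in \<open>fastforce simp: abs_le_iff\<close>)
  ultimately show "\<bar>policy_cost AA \<phi> \<pi> x\<bar> \<le> s + b * W x"
    using P by (simp add: set_lebesgue_integral_const_prob del: minus_add_distrib)
qed

lemma cost_measurable:
  "(\<lambda>(x, a). c x a) \<in> borel_measurable (Borel_on (feasible_pairs X AA))"
  using mcp by (simp add: markov_control_process_def)

lemma risk_measurable:
  "v \<in> Bw X w \<Longrightarrow> (\<lambda>(x, a). \<R> x a v) \<in> borel_measurable (Borel_on (feasible_pairs X AA))"
  using risk_map by (simp add: risk_map_def)

lemma risk_integrable: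
  assumes "\<pi> \<in> kernels X A AA" "v \<in> Bw X w" "x \<in> X"
  shows "set_integrable (\<pi> x) (AA x) (\<lambda>a. \<R> x a v)"
  using risk_bound[OF assms(2)]
    policy_cost_integrable[OF assms(1) risk_measurable[OF assms(2)] assms(3)] assms(3) by metis

lemma cost_integrable:
  assumes "\<pi> \<in> kernels X A AA" "x \<in> X"
  shows "set_integrable (\<pi> x) (AA x) (c x)"
  using policy_cost_integrable[OF assms(1) cost_measurable assms(2)] cost_bound[OF assms(2)]
  by metis

text \<open>Keeps the nested recursion inside the domain where the risk measures are monotone and
  translation invariant. The policy varies in the induction because the recursion shifts it.\<close>

lemma total_risk_in_Bw:
  assumes "\<pi> \<in> markov_policies X A AA"
  shows "total_risk AA c \<R> T \<pi> \<in> Bw X w"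
  using assms
proof (induction T arbitrary: \<pi>)
  case 0
  then show ?case
    using policy_cost_in_Bw[OF _ cost_measurable cost_bound] by (simp add: markov_policies_def)
next
  case (Suc T)
  let ?v = "total_risk AA c \<R> T (\<lambda>t. \<pi> (Suc t))"
  have \<pi>: "\<pi> 0 \<in> kernels X A AA" and v: "?v \<in> Bw X w"
    using Suc by (auto simp: markov_policies_def)
  have "policy_risk AA \<R> (\<pi> 0) ?v \<in> Bw X w"
    using policy_cost_in_Bw[OF \<pi> risk_measurable[OF v]] risk_bound[OF v]
    unfolding policy_risk_conv_policy_cost by metis
  then show ?case
    using Bw_add[OF policy_cost_in_Bw[OF \<pi> cost_measurable cost_bound]] by simp
qed

section \<open>One-step estimates for a policy\<close>

text \<open>The error term of \<open>risk_step\<close> does not depend on the action, so averaging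
  over a probability measure leaves it unchanged.\<close>

lemma policy_risk_step:
  assumes \<pi>: "\<pi> \<in> kernels X A AA" and x: "x \<in> X"
    and v: "v \<in> Bw X w" and u: "u \<in> Bw X w" and b: "0 < b"
    and le: "\<And>y. y \<in> X \<Longrightarrow> v y \<le> u y + s + b * W y"
  shows "policy_risk AA \<R> \<pi> v x \<le> policy_risk AA \<R> \<pi> u x + s + b * (\<gamma> * W x + K)"
proof -
  note P = kernel_prob_space[OF \<pi> x]
  interpret prob_space "\<pi> x" by (rule P)
  let ?k = "s + b * (\<gamma> * W x + K)"
  note C = set_integrable_const[OF P(4), of ?k]
  have "policy_risk AA \<R> \<pi> v x \<le> (LINT a:AA x|\<pi> x. \<R> x a u + ?k)"
    unfolding policy_risk_def
  proof (rule set_integral_mono)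
    show "\<R> x a v \<le> \<R> x a u + ?k" if "a \<in> AA x" for a
      using risk_step[OF x that v u b le] by simp
  qed (use risk_integrable[OF \<pi> _ x] u v C in auto)
  also have "\<dots> = policy_risk AA \<R> \<pi> u x + ?k"
    using P risk_integrable[OF \<pi> u x] C
    by (simp add: set_integral_add policy_risk_def set_lebesgue_integral_const_prob)
  finally show ?thesis by simp
qed

lemma policy_risk_zero:
  assumes "\<pi> \<in> kernels X A AA" "x \<in> X"
  shows "policy_risk AA \<R> \<pi> (\<lambda>x. 0) x = 0"
proof -
  have "(LINT a:AA x|\<pi> x. \<R> x a (\<lambda>x. 0)) = (LINT a:AA x|\<pi> x. 0)"
    using risk_zero[OF assms(2)] kernel_prob_space(4)[OF assms]
    by (intro set_lebesgue_integral_cong) auto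
  then show ?thesis by (simp add: policy_risk_def set_lebesgue_integral_def)
qed

text \<open>A randomized action averages values that each dominate the infimum in the optimality
  equation.\<close>

lemma aroe_policy_le:
  assumes \<pi>: "\<pi> \<in> kernels X A AA" and x: "x \<in> X" and sol: "aroe_solution X AA c \<R> w \<rho> h"
  shows "\<rho> + h x \<le> policy_cost AA c \<pi> x + policy_risk AA \<R> \<pi> h x"
proof -
  note P = kernel_prob_space[OF \<pi> x]
  interpret prob_space "\<pi> x" by (rule P)
  have h: "h \<in> Bw X w" using sol by (simp add: aroe_solution_def)
  have I: "set_integrable (\<pi> x) (AA x) (c x)" "set_integrable (\<pi> x) (AA x) (\<lambda>a. \<R> x a h)"
    using cost_integrable[OF \<pi> x] risk_integrable[OF \<pi> h x] .
  have "\<rho> + h x \<le> c x a + \<R> x a h" if "a \<in> AA x" for a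
  proof -
    have "ereal (\<rho> + h x) = aroe_rhs AA c \<R> h x" using sol x by (simp add: aroe_solution_def)
    also have "\<dots> \<le> ereal (c x a + \<R> x a h)"
      unfolding aroe_rhs_def by (rule INF_lower) (rule that)
    finally show ?thesis by simp
  qed
  then have "(LINT a:AA x|\<pi> x. \<rho> + h x) \<le> (LINT a:AA x|\<pi> x. c x a + \<R> x a h)"
    using P I by (intro set_integral_mono set_integral_add set_integrable_const) auto
  also have "\<dots> = policy_cost AA c \<pi> x + policy_risk AA \<R> \<pi> h x"
    using I by (simp add: policy_cost_def policy_risk_def set_integral_add)
  finally show ?thesis using P by (simp add: set_lebesgue_integral_const_prob)
qed

section \<open>Total risk compared over a finite horizon\<close>

text \<open>\<open>K / (1 - \<gamma>)\<close> is the fixed point of the affine map sending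
  \<open>t\<close> to \<open>\<gamma> * t + K\<close>; measured from it, the drift is multiplication
  by \<open>\<gamma>\<close>.\<close>

lemma drift_offset:
  "d * (\<gamma> * W x + K) = d * K / (1 - \<gamma>) + d * \<gamma> * (W x - K / (1 - \<gamma>))"
proof -
  have "d * (\<gamma> * W x + K) * (1 - \<gamma>) = d * K + d * \<gamma> * (W x * (1 - \<gamma>) - K)"
    by (simp add: algebra_simps)
  then show ?thesis using \<gamma> by (simp add: divide_simps)
qed

text \<open>
  \<open>b + b * K / (1 - \<gamma>)\<close> is the limit of the accumulated constants \<open>b + (\<Sum>n<T. b * \<gamma> ^ n * K)\<close>; the
  last summand removes the geometric tail and adds the current multiple of \<open>W\<close>.
\<close>

lemma total_risk_lower:
  assumes \<pi>: "\<pi> \<in> markov_policies X A AA" and h: "h \<in> Bw X w"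
    and b: "0 < b" "\<And>x. x \<in> X \<Longrightarrow> \<bar>h x\<bar> \<le> b + b * W x"
    and step: "\<And>t x. x \<in> X \<Longrightarrow>
      \<rho> + h x \<le> policy_cost AA c (\<pi> t) x + policy_risk AA \<R> (\<pi> t) h x"
    and x: "x \<in> X"
  shows "real (Suc T) * \<rho> + h x
    \<le> total_risk AA c \<R> T \<pi> x + b + b * K / (1 - \<gamma>) + b * \<gamma> ^ Suc T * (W x - K / (1 - \<gamma>))"
  using \<pi> step x
proof (induction T arbitrary: \<pi> x)
  case 0
  have \<pi>: "\<pi> 0 \<in> kernels X A AA" using 0 by (simp add: markov_policies_def)
  \<comment> \<open>Horizon \<open>T\<close> has \<open>T + 1\<close> stage costs, and a terminal
    value placed after the last of them passes through \<open>T + 1\<close> risk operators. Hence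
    one drift step occurs already at horizon 0.\<close>
  have "policy_risk AA \<R> (\<pi> 0) h x \<le> b + b * (\<gamma> * W x + K)"
    using policy_risk_step[OF \<pi> 0(3) h Bw_const[of 0] b(1), of b] b(2)
      policy_risk_zero[OF \<pi> 0(3)] by (fastforce simp: abs_le_iff)
  also have "\<dots> = b + b * K / (1 - \<gamma>) + b * \<gamma> * (W x - K / (1 - \<gamma>))"
    unfolding drift_offset by simp
  finally show ?case using 0(2)[of x 0] 0(3) by simp
next
  case (Suc T)
  let ?\<pi> = "\<lambda>t. \<pi> (Suc t)"
  let ?v = "total_risk AA c \<R> T ?\<pi>"
  \<comment> \<open>All terms of the induction hypothesis free of \<open>W\<close>; the remaining
    coefficient \<open>b * \<gamma> ^ Suc T\<close> of \<open>W\<close> plays the role of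
    \<open>b\<close> in the next step.\<close>
  let ?s = "b + b * K / (1 - \<gamma>) - b * \<gamma> ^ Suc T * K / (1 - \<gamma>) - real (Suc T) * \<rho>"
  have \<pi>: "\<pi> 0 \<in> kernels X A AA" and \<pi>': "?\<pi> \<in> markov_policies X A AA"
    using Suc.prems by (auto simp: markov_policies_def)
  have "policy_risk AA \<R> (\<pi> 0) h x
    \<le> policy_risk AA \<R> (\<pi> 0) ?v x + ?s + (b * \<gamma> ^ Suc T) * (\<gamma> * W x + K)"
  proof (rule policy_risk_step[OF \<pi> Suc.prems(3) h total_risk_in_Bw[OF \<pi>']])
    show "0 < b * \<gamma> ^ Suc T" using b \<gamma> by simp
    show "h y \<le> ?v y + ?s + (b * \<gamma> ^ Suc T) * W y" if "y \<in> X" for y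
      using Suc.IH[OF \<pi>' Suc.prems(2) that] by (simp add: algebra_simps)
  qed
  \<comment> \<open>The constant produced by \<open>drift_offset\<close> cancels the negative
    multiple of \<open>K\<close> in \<open>?s\<close>, so the constants do not grow with the
    horizon.\<close>
  also have "\<dots> = policy_risk AA \<R> (\<pi> 0) ?v x - real (Suc T) * \<rho>
      + b + b * K / (1 - \<gamma>) + b * \<gamma> ^ Suc (Suc T) * (W x - K / (1 - \<gamma>))"
    unfolding drift_offset by (simp add: algebra_simps)
  finally show ?case using Suc.prems(2)[of x 0] Suc.prems(3) by (simp add: algebra_simps)
qed

text \<open>The comparison of \<open>total_risk_lower\<close> with the two terminal values
  exchanged; the bound on \<open>h\<close> is two-sided, so the error is the same.\<close>

lemma total_risk_upper:
  assumes \<pi>: "\<pi> \<in> markov_policies X A AA" and h: "h \<in> Bw X w"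
    and b: "0 < b" "\<And>x. x \<in> X \<Longrightarrow> \<bar>h x\<bar> \<le> b + b * W x"
    and step: "\<And>t x. x \<in> X \<Longrightarrow>
      policy_cost AA c (\<pi> t) x + policy_risk AA \<R> (\<pi> t) h x \<le> \<rho> + h x"
    and x: "x \<in> X"
  shows "total_risk AA c \<R> T \<pi> x
    \<le> real (Suc T) * \<rho> + h x + b + b * K / (1 - \<gamma>) + b * \<gamma> ^ Suc T * (W x - K / (1 - \<gamma>))"
  using \<pi> step x
proof (induction T arbitrary: \<pi> x)
  case 0
  have \<pi>: "\<pi> 0 \<in> kernels X A AA" using 0 by (simp add: markov_policies_def)
  \<comment> \<open>The 0 on the left is the policy risk of the terminal value 0.\<close>
  have "0 \<le> policy_risk AA \<R> (\<pi> 0) h x + b + b * (\<gamma> * W x + K)"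
    using policy_risk_step[OF \<pi> 0(3) Bw_const[of 0] h b(1), of b] b(2)
      policy_risk_zero[OF \<pi> 0(3)] by (fastforce simp: abs_le_iff)
  also have "\<dots> = policy_risk AA \<R> (\<pi> 0) h x
      + b + b * K / (1 - \<gamma>) + b * \<gamma> * (W x - K / (1 - \<gamma>))"
    unfolding drift_offset by simp
  finally show ?case using 0(2)[of x 0] 0(3) by simp
next
  case (Suc T)
  let ?\<pi> = "\<lambda>t. \<pi> (Suc t)"
  let ?v = "total_risk AA c \<R> T ?\<pi>"
  let ?s = "b + b * K / (1 - \<gamma>) - b * \<gamma> ^ Suc T * K / (1 - \<gamma>) + real (Suc T) * \<rho>"
  have \<pi>: "\<pi> 0 \<in> kernels X A AA" and \<pi>': "?\<pi> \<in> markov_policies X A AA"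
    using Suc.prems by (auto simp: markov_policies_def)
  have "policy_risk AA \<R> (\<pi> 0) ?v x
    \<le> policy_risk AA \<R> (\<pi> 0) h x + ?s + (b * \<gamma> ^ Suc T) * (\<gamma> * W x + K)"
  proof (rule policy_risk_step[OF \<pi> Suc.prems(3) total_risk_in_Bw[OF \<pi>'] h])
    show "0 < b * \<gamma> ^ Suc T" using b \<gamma> by simp
    show "?v y \<le> h y + ?s + (b * \<gamma> ^ Suc T) * W y" if "y \<in> X" for y
      using Suc.IH[OF \<pi>' Suc.prems(2) that] by (simp add: algebra_simps)
  qed
  also have "\<dots> = policy_risk AA \<R> (\<pi> 0) h x + real (Suc T) * \<rho>
      + b + b * K / (1 - \<gamma>) + b * \<gamma> ^ Suc (Suc T) * (W x - K / (1 - \<gamma>))"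
    unfolding drift_offset by (simp add: algebra_simps)
  finally show ?case using Suc.prems(2)[of x 0] Suc.prems(3) by (simp add: algebra_simps)
qed

section \<open>Passage to the average and optimality\<close>

lemma average_linear_limit:
  "(\<lambda>T. ereal (1 / real T * (real (Suc T) * \<rho> + p + q * \<gamma> ^ Suc T))) \<longlonglongrightarrow> ereal \<rho>"
proof -
  have "(\<lambda>T. \<gamma> * \<gamma> ^ T) \<longlonglongrightarrow> \<gamma> * 0"
    using \<gamma> by (intro tendsto_intros LIMSEQ_realpow_zero) auto
  then have "(\<lambda>T. \<rho> + 1 / real T * (\<rho> + p + q * \<gamma> ^ Suc T)) \<longlonglongrightarrow> \<rho> + 0 * (\<rho> + p + q * 0)"
    by (intro tendsto_intros lim_1_over_n) simp
  \<comment> \<open>At \<open>T = 0\<close> the convention \<open>1 / 0 = 0\<close> makes the sides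
    \<open>\<rho>\<close> and 0, so the identity is claimed for positive \<open>T\<close>.\<close>
  moreover have "\<forall>\<^sub>F T in sequentially. \<rho> + 1 / real T * (\<rho> + p + q * \<gamma> ^ Suc T)
      = 1 / real T * (real (Suc T) * \<rho> + p + q * \<gamma> ^ Suc T)"
    using eventually_gt_at_top[of 0] by eventually_elim (simp add: field_simps)
  ultimately have "(\<lambda>T. 1 / real T * (real (Suc T) * \<rho> + p + q * \<gamma> ^ Suc T)) \<longlonglongrightarrow> \<rho>"
    by (simp add: filterlim_cong)
  then show ?thesis by (simp del: of_nat_Suc power_Suc)
qed

lemma le_average_risk:
  assumes \<pi>: "\<pi> \<in> markov_policies X A AA" and sol: "aroe_solution X AA c \<R> w \<rho> h"
    and x: "x \<in> X"
  shows "ereal \<rho> \<le> average_risk AA c \<R> x \<pi>"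
proof -
  have h: "h \<in> Bw X w" using sol by (simp add: aroe_solution_def)
  obtain b where b: "0 < b" "\<And>x. x \<in> X \<Longrightarrow> \<bar>h x\<bar> \<le> b + b * W x" using Bw_E[OF h] by blast
  define p where "p = h x - b - b * K / (1 - \<gamma>)"
  \<comment> \<open>\<open>p\<close> and \<open>q\<close> are independent of the horizon; the sign
    turns because the error moves to the other side.\<close>
  define q where "q = - b * (W x - K / (1 - \<gamma>))"
  have "real (Suc T) * \<rho> + p + q * \<gamma> ^ Suc T \<le> total_risk AA c \<R> T \<pi> x" for T
    using total_risk_lower[OF \<pi> h b aroe_policy_le[OF _ _ sol] x, of T] \<pi>
    by (simp add: markov_policies_def p_def q_def algebra_simps)
  then have "limsup (\<lambda>T. ereal (1 / real T * (real (Suc T) * \<rho> + p + q * \<gamma> ^ Suc T)))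
    \<le> average_risk AA c \<R> x \<pi>"
    unfolding average_risk_def
    by (intro Limsup_mono always_eventually allI) (simp del: of_nat_Suc power_Suc add: divide_right_mono)
  then show ?thesis using lim_imp_Limsup[OF _ average_linear_limit] by simp
qed

lemma average_risk_selector_le:
  assumes sel: "optimal_selector X A AA c \<R> h f" and sol: "aroe_solution X AA c \<R> w \<rho> h"
    and x: "x \<in> X"
  shows "stationary f \<in> markov_policies X A AA" "average_risk AA c \<R> x (stationary f) \<le> ereal \<rho>"
proof -
  show \<pi>: "stationary f \<in> markov_policies X A AA"
    using sel by (auto simp: optimal_selector_def det_kernels_def markov_policies_def stationary_def)
  have h: "h \<in> Bw X w" using sol by (simp add: aroe_solution_def)
  obtain b where b: "0 < b" "\<And>x. x \<in> X \<Longrightarrow> \<bar>h x\<bar> \<le> b + b * W x" using Bw_E[OF h] by blast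
  have step: "policy_cost AA c (stationary f t) y + policy_risk AA \<R> (stationary f t) h y \<le> \<rho> + h y"
    if "y \<in> X" for t y
  proof -
    \<comment> \<open>Both sides equal \<open>aroe_rhs\<close>: the selector attains the infimum and
      \<open>(\<rho>, h)\<close> solves the equation.\<close>
    have "ereal (policy_cost AA c f y + policy_risk AA \<R> f h y) = ereal (\<rho> + h y)"
      using sel sol that unfolding optimal_selector_def aroe_solution_def by metis
    then show ?thesis by (simp add: stationary_def)
  qed
  define p where "p = h x + b + b * K / (1 - \<gamma>)"
  define q where "q = b * (W x - K / (1 - \<gamma>))"
  have "total_risk AA c \<R> T (stationary f) x \<le> real (Suc T) * \<rho> + p + q * \<gamma> ^ Suc T" for T
    using total_risk_upper[OF \<pi> h b step x, of T] by (simp add: p_def q_def algebra_simps)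
  then have "average_risk AA c \<R> x (stationary f)
    \<le> limsup (\<lambda>T. ereal (1 / real T * (real (Suc T) * \<rho> + p + q * \<gamma> ^ Suc T)))"
    unfolding average_risk_def
    by (intro Limsup_mono always_eventually allI) (simp del: of_nat_Suc power_Suc add: divide_right_mono)
  then show "average_risk AA c \<R> x (stationary f) \<le> ereal \<rho>"
    using lim_imp_Limsup[OF _ average_linear_limit] by simp
qed

end

theorem theorem5p10:
  fixes X :: "'x::polish_space set" and A :: "'a::polish_space set"
    and AA :: "'x \<Rightarrow> 'a set" and Q :: "'x \<times> 'a \<Rightarrow> 'x measure" and c :: "'x \<Rightarrow> 'a \<Rightarrow> real"
    and W w :: "'x \<Rightarrow> real" and K \<gamma> \<alpha> \<alpha>\<^sub>0 \<beta> R c_bar :: real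
    and \<R> :: "'x \<Rightarrow> 'a \<Rightarrow> ('x \<Rightarrow> real) \<Rightarrow> real" and \<nu> :: "('x \<Rightarrow> real) \<Rightarrow> real"
    and \<rho> :: real and h :: "'x \<Rightarrow> real" and f :: "'x \<Rightarrow> 'a measure"
  assumes mcp: "markov_control_process X A AA Q c"
    and W_meas: "W \<in> borel_measurable (Borel_on X)" and W_nonneg: "\<forall>x\<in>X. 0 \<le> W x"
    and K: "0 < K" and \<gamma>: "0 < \<gamma>" "\<gamma> < 1" and \<alpha>: "0 < \<alpha>" "\<alpha> < 1" and \<alpha>\<^sub>0: "0 < \<alpha>\<^sub>0" "\<alpha>\<^sub>0 < \<alpha>"
    and \<beta>: "\<beta> = \<alpha>\<^sub>0 / K" and w: "w = (\<lambda>x. 1 + \<beta> * W x)"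
    and risk_map: "risk_map X AA w \<R>" and risk_measure: "risk_measure X w \<nu>"
    and drift: "\<forall>(x, a)\<in>feasible_pairs X AA. sharp_bar X w (\<R> x a) W \<le> ereal (\<gamma> * W x + K)"
    and R: "R > 2 * K / (1 - \<gamma>)"
    and minorization: "\<forall>v\<in>Bw X w. \<forall>u\<in>Bw X w. (\<forall>x\<in>X. u x \<le> v x) \<longrightarrow>
      (INF (x, a)\<in>{(x, a)\<in>feasible_pairs X AA. x \<in> {x\<in>X. W x \<le> R}}.
         ereal (\<R> x a v - \<alpha> * \<nu> v - \<R> x a u + \<alpha> * \<nu> u)) \<ge> 0"
    and c_bar: "0 \<le> c_bar" "\<forall>x\<in>X. (SUP a\<in>AA x. ereal \<bar>c x a\<bar>) \<le> ereal (c_bar * w x)"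
    and lsc: "\<forall>x\<in>X. lower_semicontinuous_on (AA x) (c x)"
    and compact: "\<forall>x\<in>X. compact (AA x)"
    and cont: "\<forall>x\<in>X. \<forall>u\<in>Bw X w. continuous_on (AA x) (\<lambda>a. \<R> x a u)"
    and solution: "aroe_solution X AA c \<R> w \<rho> h"
    and selector: "optimal_selector X A AA c \<R> h f"
  shows "\<forall>x\<in>X. ereal \<rho> = optimal_average_risk X A AA c \<R> x \<and>
                optimal_average_risk X A AA c \<R> x = average_risk AA c \<R> x (stationary f)"
proof
  fix x assume x: "x \<in> X"
  \<comment> \<open>\<open>0 < \<beta>\<close> follows from
    \<open>\<beta> = \<alpha>\<^sub>0 / K\<close>, a quotient of positive numbers.\<close>
  interpret drift_risk_map X A AA Q c W w K \<gamma> \<beta> c_bar \<R>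
    using assms by unfold_locales auto
  note f = average_risk_selector_le[OF selector solution x]
  \<comment> \<open>The inequalities run from \<open>\<rho>\<close> through the optimal average risk
    and the average risk of \<open>stationary f\<close> back to \<open>\<rho>\<close>, which forces
    equality throughout.\<close>
  have "ereal \<rho> \<le> optimal_average_risk X A AA c \<R> x"
    unfolding optimal_average_risk_def by (intro INF_greatest le_average_risk[OF _ solution x])
  moreover have "optimal_average_risk X A AA c \<R> x \<le> average_risk AA c \<R> x (stationary f)"
    unfolding optimal_average_risk_def by (rule INF_lower) (rule f)
  ultimately show "ereal \<rho> = optimal_average_risk X A AA c \<R> x \<and>
      optimal_average_risk X A AA c \<R> x = average_risk AA c \<R> x (stationary f)"
    using f(2) by (intro conjI antisym) auto
qed

end
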